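(* Let $L(\alpha)\in CE(\mu_4)$ with $\alpha=(b_{0,0},b_{0,1},b_{1,1},b_{1,2})$ and let $\Delta=b_{0,1}^2-4b_{0,0}b_{1,1}$. (1) If $b_{1,1}\neq0$, $b_{1,2}=0$, $\Delta\neq0$, then $L(\alpha)$ is isomorphic to $L(1,0,1,0)$. (2) If $b_{1,1}\neq0$, $b_{1,2}=\Delta=0$, then $L(\alpha)$ is isomorphic to $L(0,0,1,0)$. (3) If $b_{1,1}=0$, $b_{0,1}\neq0$, $b_{1,2}\neq0$, then $L(\alpha)$ is isomorphic to $L(0,1,0,1)$. (4) If $b_{1,1}=0$, $b_{0,1}\neq0$, $b_{1,2}=0$, then $L(\alpha)$ is isomorphic to $L(0,1,0,0)$. (5) If $b_{1,1}=b_{0,1}=0$, $b_{0,0}\neq0$, $b_{1,2}\neq0$, then $L(\alpha)$ is isomorphic to $L(1,0,0,1)$. (6) If $b_{1,1}=b_{0,1}=0$, $b_{0,0}\neq0$, $b_{1,2}=0$, then $L(\alpha)$ is isomorphic to $L(1,0,0,0)$. (7) If $b_{1,1}=b_{0,1}=b_{0,0}=0$, $b_{1,2}\neq0$, then $L(\alpha)$ is isomorphic to $L(0,0,0,1)$. (8) If $b_{1,1}=b_{0,1}=b_{0,0}=b_{1,2}=0$, then $L(\alpha)$ is isomorphic to $L(0,0,0,0)$.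
   Context: A Leibniz algebra over $\mathbb{C}$ is a complex vector space with a bilinear bracket satisfying $[x,[y,z]]=[[x,y],z]-[[x,z],y]$. $CE(\mu_4)$ (one-dimensional Leibniz central extensions of the 4-dimensional naturally graded filiform Lie algebra $\mu_4$) is the class of the 5-dimensional complex Leibniz algebras $L(\alpha)$, $\alpha=(b_{0,0},b_{0,1},b_{1,1},b_{1,2})\in\mathbb{C}^4$, with basis $e_0,\dots,e_4$ and brackets $[e_i,e_0]=e_{i+1}$ ($1\le i\le 3$), $[e_0,e_i]=-e_{i+1}$ ($2\le i\le 3$), $[e_0,e_0]=b_{0,0}e_4$, $[e_0,e_1]=-e_2+b_{0,1}e_4$, $[e_1,e_1]=b_{1,1}e_4$, $[e_1,e_2]=-[e_2,e_1]=b_{1,2}e_4$, all other brackets of basis vectors being zero. Isomorphic means isomorphic as Leibniz algebras. *)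

theory Defs
  imports "HOL-Analysis.Cartesian_Space" "HOL-Library.Numeral_Type"
begin

text \<open>Right Leibniz algebras over the complex numbers. The type carrying the algebra is the
  whole underlying space.\<close>

locale leibniz_algebra = vector_space scale
  for scale :: "complex \<Rightarrow> 'a::ab_group_add \<Rightarrow> 'a"
  and bracket :: "'a \<Rightarrow> 'a \<Rightarrow> 'a" +
  assumes linear_left: "Vector_Spaces.linear scale scale (\<lambda>x. bracket x y)"
    and linear_right: "Vector_Spaces.linear scale scale (\<lambda>y. bracket x y)"
    and leibniz: "bracket x (bracket y z) = bracket (bracket x y) z - bracket (bracket x z) y"

definition leibniz_isomorphic ::
  "(complex \<Rightarrow> 'a::ab_group_add \<Rightarrow> 'a) \<Rightarrow> ('a \<Rightarrow> 'a \<Rightarrow> 'a) \<Rightarrow>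
   (complex \<Rightarrow> 'b::ab_group_add \<Rightarrow> 'b) \<Rightarrow> ('b \<Rightarrow> 'b \<Rightarrow> 'b) \<Rightarrow> bool" where
  "leibniz_isomorphic s1 br1 s2 br2 \<longleftrightarrow>
     leibniz_algebra s1 br1 \<and> leibniz_algebra s2 br2 \<and>
     (\<exists>f. Vector_Spaces.linear s1 s2 f \<and> bij f \<and> (\<forall>x y. f (br1 x y) = br2 (f x) (f y)))"

text \<open>The index type \<open>5\<close> has the elements \<open>0, 1, 2, 3, 4\<close>. Its addition is modulo \<open>5\<close>, but
  below \<open>i + 1\<close> is formed only for \<open>i \<in> {1, 2, 3}\<close>, where nothing wraps around.\<close>

abbreviation e :: "5 \<Rightarrow> complex ^ 5" where
  "e i \<equiv> axis i 1"

definition CE_table :: "complex \<Rightarrow> complex \<Rightarrow> complex \<Rightarrow> complex \<Rightarrow> 5 \<Rightarrow> 5 \<Rightarrow> complex ^ 5" where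
  "CE_table b00 b01 b11 b12 i j =
    (if i \<in> {1, 2, 3} \<and> j = 0 then e (i + 1)
     else if i = 0 \<and> j \<in> {2, 3} then - e (j + 1)
     else if i = 0 \<and> j = 0 then b00 *s e 4
     else if i = 0 \<and> j = 1 then - e 2 + b01 *s e 4
     else if i = 1 \<and> j = 1 then b11 *s e 4
     else if i = 1 \<and> j = 2 then b12 *s e 4
     else if i = 2 \<and> j = 1 then - (b12 *s e 4)
     else 0)"

text \<open>The bracket of \<open>L(b00, b01, b11, b12)\<close> on \<open>complex ^ 5\<close>: the bilinear extension of the
  table of brackets of basis vectors.\<close>

definition L :: "complex \<Rightarrow> complex \<Rightarrow> complex \<Rightarrow> complex \<Rightarrow>
    complex ^ 5 \<Rightarrow> complex ^ 5 \<Rightarrow> complex ^ 5" where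
  "L b00 b01 b11 b12 x y =
    (\<Sum>i\<in>UNIV. \<Sum>j\<in>UNIV. (x $ i * y $ j) *s CE_table b00 b01 b11 b12 i j)"

abbreviation L_isomorphic ::
  "(complex ^ 5 \<Rightarrow> complex ^ 5 \<Rightarrow> complex ^ 5) \<Rightarrow>
   (complex ^ 5 \<Rightarrow> complex ^ 5 \<Rightarrow> complex ^ 5) \<Rightarrow> bool" (infix "\<cong>\<^sub>L" 50) where
  "A \<cong>\<^sub>L B \<equiv> leibniz_isomorphic (*s) A (*s) B"

lemma L_basis: "L b00 b01 b11 b12 (e i) (e j) = CE_table b00 b01 b11 b12 i j"
proof -
  have "L b00 b01 b11 b12 (e i) (e j) =
      (\<Sum>k\<in>UNIV. \<Sum>l\<in>UNIV. if l = j then (if k = i then CE_table b00 b01 b11 b12 k l else 0) else 0)"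
    unfolding L_def by (intro sum.cong refl) (auto simp: axis_def)
  then show ?thesis by simp
qed

lemma UNIV_5: "(UNIV :: 5 set) = {0, 1, 2, 3, 4}"
proof -
  have "x = 0 \<or> x = 1 \<or> x = 2 \<or> x = 3 \<or> x = 4" for x :: 5
  proof (induct x)
    case (of_int z)
    then have "z = 0 \<or> z = 1 \<or> z = 2 \<or> z = 3 \<or> z = 4" by auto
    then show ?case by auto
  qed
  then show ?thesis by auto
qed

lemma L_nth:
  "L b00 b01 b11 b12 x y $ 0 = 0"
  "L b00 b01 b11 b12 x y $ 1 = 0"
  "L b00 b01 b11 b12 x y $ 2 = x$1 * y$0 - x$0 * y$1"
  "L b00 b01 b11 b12 x y $ 3 = x$2 * y$0 - x$0 * y$2"
  "L b00 b01 b11 b12 x y $ 4 = x$3 * y$0 - x$0 * y$3 + b00 * x$0 * y$0 + b01 * x$0 * y$1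
     + b11 * x$1 * y$1 + b12 * (x$1 * y$2 - x$2 * y$1)"
  unfolding L_def UNIV_5 by (simp_all add: CE_table_def axis_def right_diff_distrib mult.assoc mult.commute)

lemma vec5_eq_iff:
  "(v :: complex ^ 5) = w \<longleftrightarrow> v$0 = w$0 \<and> v$1 = w$1 \<and> v$2 = w$2 \<and> v$3 = w$3 \<and> v$4 = w$4"
proof -
  have "v = w \<longleftrightarrow> (\<forall>i\<in>{0, 1, 2, 3, 4}. v $ i = w $ i)"
    unfolding vec_eq_iff UNIV_5[symmetric] by simp
  then show ?thesis by simp
qed

lemma leibniz_algebra_L: "leibniz_algebra (*s) (L b00 b01 b11 b12)"
  by unfold_locales (simp_all add: vec5_eq_iff L_nth ring_distribs)

end

theory Submission
  imports Defs "HOL-Analysis.Complex_Transcendental"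
begin

text \<open>Sending \<open>e 0\<close> to \<open>p e 0 + q e 1\<close> and \<open>e 1\<close> to \<open>r e 1\<close> determines the images of
  \<open>e 2\<close>, \<open>e 3\<close>, \<open>e 4\<close>, since \<open>e (i + 1) = [e i, e 0]\<close> for \<open>1 \<le> i \<le> 3\<close>. The remaining brackets
  give four equations on the structure constants. Solving them for \<open>p\<close>, \<open>q\<close>, \<open>r\<close> requires
  only roots of complex numbers; they force \<open>\<Delta>' = p\<^sup>4 \<Delta>\<close> for the
  discriminant \<open>\<Delta>'\<close> of the target, and \<open>\<Delta>' = - 4\<close> for \<open>L 1 0 1 0\<close>.\<close>

lemma L_isomorphicI:
  fixes p q r :: complex
  assumes nz: "p \<noteq> 0" "r \<noteq> 0"
    and c00: "c00 * p\<^sup>2 + c01 * p * q + c11 * q\<^sup>2 = b00 * p^3 * r"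
    and c01: "c01 * p + 2 * c11 * q = b01 * p^3"
    and c11: "c11 * r = b11 * p^3"
    and c12: "c12 * r = b12 * p\<^sup>2"
  shows "L b00 b01 b11 b12 \<cong>\<^sub>L L c00 c01 c11 c12"
proof -
  \<comment> \<open>The \<open>c11\<close> and \<open>c12\<close> terms are the \<open>e 4\<close>
    parts of \<open>[r e 1, q e 1]\<close> and \<open>[p r e 2, q e 1]\<close> in the target, which
    arise in the images of \<open>e 2\<close> and \<open>e 3\<close>.\<close>
  define f :: "complex ^ 5 \<Rightarrow> complex ^ 5" where
    "f x = (\<chi> i. if i = 0 then p * x$0
       else if i = 1 then q * x$0 + r * x$1
       else if i = 2 then p * r * x$2
       else if i = 3 then p\<^sup>2 * r * x$3
       else c11 * r * q * x$2 - c12 * p * r * q * x$3 + p^3 * r * x$4)" for x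
  have f_nth: "f x $ 0 = p * x$0" "f x $ 1 = q * x$0 + r * x$1" "f x $ 2 = p * r * x$2"
    "f x $ 3 = p\<^sup>2 * r * x$3"
    "f x $ 4 = c11 * r * q * x$2 - c12 * p * r * q * x$3 + p^3 * r * x$4" for x
    by (simp_all add: f_def)
  have lin: "Vector_Spaces.linear (*s) (*s) f"
    by unfold_locales (simp_all add: vec5_eq_iff f_nth algebra_simps)
  \<comment> \<open>\<open>f\<close> is triangular with diagonal p, r, p r, p^2 r, p^3 r.\<close>
  have "inj f"
    using nz by (auto simp: inj_def vec5_eq_iff f_nth)
  then have "bij f"
    using lin vec.linear_inj_imp_surj by (auto simp: bij_def)
  moreover have "f (L b00 b01 b11 b12 x y) = L c00 c01 c11 c12 (f x) (f y)" for x y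
  proof -
    \<comment> \<open>The source constants enter only the last coordinate; regrouping exposes the
      right-hand sides of the four hypotheses.\<close>
    have "p^3 * r * (b00 * x$0 * y$0 + b01 * x$0 * y$1 + b11 * x$1 * y$1
        + b12 * (x$1 * y$2 - x$2 * y$1))
      = (b00 * p^3 * r) * x$0 * y$0 + (b01 * p^3) * r * x$0 * y$1 + (b11 * p^3) * r * x$1 * y$1
        + (b12 * p\<^sup>2) * p * r * (x$1 * y$2 - x$2 * y$1)"
      by algebra
    also have "\<dots> = (c00 * p\<^sup>2 + c01 * p * q + c11 * q\<^sup>2) * x$0 * y$0
        + (c01 * p + 2 * c11 * q) * r * x$0 * y$1 + (c11 * r) * r * x$1 * y$1
        + (c12 * r) * p * r * (x$1 * y$2 - x$2 * y$1)"
      by (simp only: c00 c01 c11 c12)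
    finally show ?thesis
      by (simp add: vec5_eq_iff L_nth f_nth) (simp add: algebra_simps power2_eq_square power3_eq_cube)
  qed
  ultimately show ?thesis
    unfolding leibniz_isomorphic_def using leibniz_algebra_L lin by blast
qed

theorem proposition3p5:
  fixes b00 b01 b11 b12 \<Delta> :: complex
  assumes "\<Delta> = b01\<^sup>2 - 4 * b00 * b11"
  shows "(b11 \<noteq> 0 \<and> b12 = 0 \<and> \<Delta> \<noteq> 0 \<longrightarrow> L b00 b01 b11 b12 \<cong>\<^sub>L L 1 0 1 0) \<and>
    (b11 \<noteq> 0 \<and> b12 = 0 \<and> \<Delta> = 0 \<longrightarrow> L b00 b01 b11 b12 \<cong>\<^sub>L L 0 0 1 0) \<and>
    (b11 = 0 \<and> b01 \<noteq> 0 \<and> b12 \<noteq> 0 \<longrightarrow> L b00 b01 b11 b12 \<cong>\<^sub>L L 0 1 0 1) \<and>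
    (b11 = 0 \<and> b01 \<noteq> 0 \<and> b12 = 0 \<longrightarrow> L b00 b01 b11 b12 \<cong>\<^sub>L L 0 1 0 0) \<and>
    (b11 = 0 \<and> b01 = 0 \<and> b00 \<noteq> 0 \<and> b12 \<noteq> 0 \<longrightarrow> L b00 b01 b11 b12 \<cong>\<^sub>L L 1 0 0 1) \<and>
    (b11 = 0 \<and> b01 = 0 \<and> b00 \<noteq> 0 \<and> b12 = 0 \<longrightarrow> L b00 b01 b11 b12 \<cong>\<^sub>L L 1 0 0 0) \<and>
    (b11 = 0 \<and> b01 = 0 \<and> b00 = 0 \<and> b12 \<noteq> 0 \<longrightarrow> L b00 b01 b11 b12 \<cong>\<^sub>L L 0 0 0 1) \<and>
    (b11 = 0 \<and> b01 = 0 \<and> b00 = 0 \<and> b12 = 0 \<longrightarrow> L b00 b01 b11 b12 \<cong>\<^sub>L L 0 0 0 0)"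
proof (intro conjI impI)
  assume h: "b11 \<noteq> 0 \<and> b12 = 0 \<and> \<Delta> \<noteq> 0"
  \<comment> \<open>With \<open>r = b11 p^3\<close> and \<open>q = b01 p^3 / 2\<close> forced, the
    equation \<open>p^2 + q^2 = b00 p^3 r\<close> becomes
    \<open>p^2 (4 + \<Delta> p^4) = 0\<close>.\<close>
  obtain p where p: "p^4 = - 4 / \<Delta>"
    by (metis exists_complex_root zero_neq_numeral)
  have "p \<noteq> 0" using p h by auto
  have "\<Delta> * p^4 = - 4" using p h by simp
  then have "p\<^sup>2 * (4 + \<Delta> * p^4) = 0"
    by simp
  then have "4 * (p\<^sup>2 + (b01 * p^3 / 2)\<^sup>2) = 4 * (b00 * p^3 * (b11 * p^3))"
    unfolding assms by (simp add: power_divide power2_eq_square eval_nat_numeral algebra_simps)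
  then have "p\<^sup>2 + (b01 * p^3 / 2)\<^sup>2 = b00 * p^3 * (b11 * p^3)"
    unfolding mult_cancel_left by simp
  then show "L b00 b01 b11 b12 \<cong>\<^sub>L L 1 0 1 0"
    using h \<open>p \<noteq> 0\<close>
    by (intro L_isomorphicI[of p "b11 * p^3" _ _ "b01 * p^3 / 2"]) auto
next
  assume h: "b11 \<noteq> 0 \<and> b12 = 0 \<and> \<Delta> = 0"
  \<comment> \<open>For \<open>p = 1\<close> the equation \<open>q^2 = b00 r\<close> reads
    \<open>(b01 / 2)^2 = b00 b11\<close>, that is, \<Delta> = 0.\<close>
  then show "L b00 b01 b11 b12 \<cong>\<^sub>L L 0 0 1 0"
    using assms by (intro L_isomorphicI[of 1 b11 _ _ "b01 / 2"]) (auto simp: field_simps)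
next
  assume h: "b11 = 0 \<and> b01 \<noteq> 0 \<and> b12 \<noteq> 0"
  \<comment> \<open>The equation \<open>p = b01 p^3\<close> fixes p up to sign; then
    \<open>r = b12 p^2\<close>, and \<open>p q = b00 p^3 r\<close> gives q.\<close>
  define p where "p = 1 / csqrt b01"
  have p: "b01 * p\<^sup>2 = 1" "p \<noteq> 0"
    using h by (auto simp: p_def power_divide)
  then have "p = b01 * p^3"
    by (simp add: power2_eq_square power3_eq_cube)
  with h p show "L b00 b01 b11 b12 \<cong>\<^sub>L L 0 1 0 1"
    by (intro L_isomorphicI[of p "b12 * p\<^sup>2" _ _ "b00 * p\<^sup>2 * (b12 * p\<^sup>2)"])
      (auto simp: power2_eq_square power3_eq_cube)
next
  assume h: "b11 = 0 \<and> b01 \<noteq> 0 \<and> b12 = 0"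
  define p where "p = 1 / csqrt b01"
  have p: "b01 * p\<^sup>2 = 1" "p \<noteq> 0"
    using h by (auto simp: p_def power_divide)
  then have "p = b01 * p^3"
    by (simp add: power2_eq_square power3_eq_cube)
  \<comment> \<open>As \<open>b12\<close> and \<open>c12\<close> both vanish, r may be any nonzero
    number.\<close>
  with h p show "L b00 b01 b11 b12 \<cong>\<^sub>L L 0 1 0 0"
    by (intro L_isomorphicI[of p 1 _ _ "b00 * p\<^sup>2"]) (auto simp: power2_eq_square power3_eq_cube)
next
  assume h: "b11 = 0 \<and> b01 = 0 \<and> b00 \<noteq> 0 \<and> b12 \<noteq> 0"
  \<comment> \<open>Putting \<open>r = b12 p^2\<close> into \<open>p^2 = b00 p^3 r\<close> leaves
    \<open>b00 b12 p^3 = 1\<close>.\<close>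
  obtain p where p: "p^3 = 1 / (b00 * b12)"
    by (metis exists_complex_root zero_neq_numeral)
  have "p \<noteq> 0" using p h by auto
  with h p show "L b00 b01 b11 b12 \<cong>\<^sub>L L 1 0 0 1"
    by (intro L_isomorphicI[of p "b12 * p\<^sup>2" _ _ 0]) auto
next
  assume h: "b11 = 0 \<and> b01 = 0 \<and> b00 \<noteq> 0 \<and> b12 = 0"
  \<comment> \<open>Only \<open>p^2 = b00 p^3 r\<close> is nontrivial here, so \<open>p = 1\<close>
    determines r.\<close>
  then show "L b00 b01 b11 b12 \<cong>\<^sub>L L 1 0 0 0"
    by (intro L_isomorphicI[of 1 "1 / b00" _ _ 0]) auto
next
  assume h: "b11 = 0 \<and> b01 = 0 \<and> b00 = 0 \<and> b12 \<noteq> 0"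
  then show "L b00 b01 b11 b12 \<cong>\<^sub>L L 0 0 0 1"
    by (intro L_isomorphicI[of 1 b12 _ _ 0]) auto
next
  assume h: "b11 = 0 \<and> b01 = 0 \<and> b00 = 0 \<and> b12 = 0"
  then show "L b00 b01 b11 b12 \<cong>\<^sub>L L 0 0 0 0"
    by (intro L_isomorphicI[of 1 1 _ _ 0]) auto
qed

end
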